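(* Let $G=(V,E)$ be a finite graph that has a cycle double cover by triangles. Choose $A,B\subseteq E$ independently and uniformly at random, and let $\Gamma$ be the event that $A$ and $B$ are both eulerian and $A\cup B=E$. Then $$\mathrm{Bias}(|A|\equiv |B|+1\ (\mathrm{mod}\ 3)\mid\Gamma)=\mathrm{Bias}(|A|\equiv|B|+2\ (\mathrm{mod}\ 3)\mid\Gamma)$$ and $$\frac{\mathrm{Bias}(|A|\equiv |B|\ (\mathrm{mod}\ 3)\mid\Gamma)-\mathrm{Bias}(|A|\equiv |B|+1\ (\mathrm{mod}\ 3)\mid\Gamma)}{\mathrm{Bias}(|A|\equiv |B|\ (\mathrm{mod}\ 3))-\mathrm{Bias}(|A|\equiv|B|+1\ (\mathrm{mod}\ 3))}=\frac{2^{3|E|-2|V|}P(G;4)}{F(G;4)}.$$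
   Context: Graphs are finite; loops and parallel edges are permitted. A cycle double cover of $G$ by triangles is a family (repetitions allowed) of triangles (cycles of length 3) of $G$ such that each edge of $G$ belongs to exactly two members of the family. A subset $A\subseteq E$ is identified with the subgraph $(V,A)$ of $G$; it is called eulerian if all its vertex degrees are even. $P(G;q)$ is the number of proper vertex $q$-colourings of $G$; $F(G;q)$ is the number of nowhere-zero $\mathbb{Z}_q$-flows of $G$ (with respect to any fixed orientation); $F(G;4)$ is also the number of nowhere-zero $\mathbb{F}_4$-flows. For an event $\Sigma$, $\mathrm{Bias}(\Sigma)=\mathbb{P}(\Sigma)-\mathbb{P}(\overline{\Sigma})$ and $\mathrm{Bias}(\Sigma\mid\Gamma)=\mathbb{P}(\Sigma\mid\Gamma)-\mathbb{P}(\overline{\Sigma}\mid\Gamma)$, where $\overline{\Sigma}$ is the complement of $\Sigma$. *)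

theory Defs
  imports
    "HOL-Probability.Probability"
    "HOL-Number_Theory.Cong"
    "HOL-Library.Uprod"
    "HOL-Library.Multiset"
begin

text \<open>
  Multigraphs: every edge has an unordered pair of end vertices. A loop at \<open>v\<close> has
  end pair \<open>Upair v v\<close>, and distinct edges may have the same end pair.
\<close>

record ('v, 'e) multigraph =
  verts :: "'v set"
  edges :: "'e set"
  ends :: "'e \<Rightarrow> 'v uprod"

definition finite_multigraph :: "('v, 'e) multigraph \<Rightarrow> bool" where
  "finite_multigraph G \<longleftrightarrow>
     finite (verts G) \<and> finite (edges G) \<and> (\<forall>e\<in>edges G. set_uprod (ends G e) \<subseteq> verts G)"

text \<open>
  A triangle is represented by its edge set, so triangles that use different parallel edges
  are different.
\<close>

definition triangle :: "('v, 'e) multigraph \<Rightarrow> 'e set \<Rightarrow> bool" where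
  "triangle G T \<longleftrightarrow>
     (\<exists>u v w e1 e2 e3. u \<noteq> v \<and> v \<noteq> w \<and> w \<noteq> u \<and>
        e1 \<in> edges G \<and> e2 \<in> edges G \<and> e3 \<in> edges G \<and>
        ends G e1 = Upair u v \<and> ends G e2 = Upair v w \<and> ends G e3 = Upair w u \<and>
        T = {e1, e2, e3})"

definition triangle_double_cover :: "('v, 'e) multigraph \<Rightarrow> 'e set multiset \<Rightarrow> bool" where
  "triangle_double_cover G C \<longleftrightarrow>
     (\<forall>T\<in>#C. triangle G T) \<and> (\<forall>e\<in>edges G. size {#T \<in># C. e \<in> T#} = 2)"

text \<open>Degree of \<open>v\<close> in the subgraph with edge set \<open>A\<close>; the second summand makes a loop count twice.\<close>

definition degree_in :: "('v, 'e) multigraph \<Rightarrow> 'e set \<Rightarrow> 'v \<Rightarrow> nat" where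
  "degree_in G A v =
     card {e \<in> A. v \<in> set_uprod (ends G e)} + card {e \<in> A. ends G e = Upair v v}"

definition eulerian :: "('v, 'e) multigraph \<Rightarrow> 'e set \<Rightarrow> bool" where
  "eulerian G A \<longleftrightarrow> A \<subseteq> edges G \<and> (\<forall>v\<in>verts G. even (degree_in G A v))"

definition proper_colourings :: "('v, 'e) multigraph \<Rightarrow> nat \<Rightarrow> ('v \<Rightarrow> nat) set" where
  "proper_colourings G q =
     {c \<in> verts G \<rightarrow>\<^sub>E {0..<q}. \<forall>e\<in>edges G. \<forall>u v. ends G e = Upair u v \<longrightarrow> c u \<noteq> c v}"

definition chromatic_count :: "('v, 'e) multigraph \<Rightarrow> nat \<Rightarrow> nat" where
  "chromatic_count G q = card (proper_colourings G q)"

definition orientation :: "('v, 'e) multigraph \<Rightarrow> ('e \<Rightarrow> 'v) \<Rightarrow> ('e \<Rightarrow> 'v) \<Rightarrow> bool" where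
  "orientation G src tgt \<longleftrightarrow> (\<forall>e\<in>edges G. ends G e = Upair (src e) (tgt e))"

text \<open>
  Elements of \<open>\<int>\<^sub>q\<close> are represented by the residues \<open>0, \<dots>, q - 1\<close>, and the
  conservation law is required modulo \<open>q\<close>.
\<close>

definition nowhere_zero_flows ::
    "('v, 'e) multigraph \<Rightarrow> ('e \<Rightarrow> 'v) \<Rightarrow> ('e \<Rightarrow> 'v) \<Rightarrow> nat \<Rightarrow> ('e \<Rightarrow> nat) set" where
  "nowhere_zero_flows G src tgt q =
     {f \<in> edges G \<rightarrow>\<^sub>E {0..<q}.
        (\<forall>e\<in>edges G. f e \<noteq> 0) \<and>
        (\<forall>v\<in>verts G.
           [(\<Sum>e | e \<in> edges G \<and> tgt e = v. f e) = (\<Sum>e | e \<in> edges G \<and> src e = v. f e)] (mod q))}"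

definition flow_count ::
    "('v, 'e) multigraph \<Rightarrow> ('e \<Rightarrow> 'v) \<Rightarrow> ('e \<Rightarrow> 'v) \<Rightarrow> nat \<Rightarrow> nat" where
  "flow_count G src tgt q = card (nowhere_zero_flows G src tgt q)"

definition random_edge_sets :: "('v, 'e) multigraph \<Rightarrow> ('e set \<times> 'e set) pmf" where
  "random_edge_sets G = pair_pmf (pmf_of_set (Pow (edges G))) (pmf_of_set (Pow (edges G)))"

definition bias :: "'a pmf \<Rightarrow> ('a \<Rightarrow> bool) \<Rightarrow> real" where
  "bias p S = measure_pmf.prob p {x. S x} - measure_pmf.prob p {x. \<not> S x}"

definition cond_bias :: "'a pmf \<Rightarrow> ('a \<Rightarrow> bool) \<Rightarrow> ('a \<Rightarrow> bool) \<Rightarrow> real" where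
  "cond_bias p S C =
     cond_prob (measure_pmf p) S C - cond_prob (measure_pmf p) (\<lambda>x. \<not> S x) C"

definition eulerian_cover :: "('v, 'e) multigraph \<Rightarrow> 'e set \<times> 'e set \<Rightarrow> bool" where
  "eulerian_cover G = (\<lambda>(A, B). eulerian G A \<and> eulerian G B \<and> A \<union> B = edges G)"

definition card_shift :: "nat \<Rightarrow> 'e set \<times> 'e set \<Rightarrow> bool" where
  "card_shift k = (\<lambda>(A, B). [card A = card B + k] (mod 3))"

end

theory Submission imports Defs begin

text \<open>
  Write \<open>\<omega>\<close> for a primitive cube root of unity. By the symmetry between \<open>A\<close> and \<open>B\<close>, both
  differences of biases are twice the mean of \<open>\<omega> ^ (|A| - |B|)\<close>; without conditioning it is \<open>4 ^ (- |E|)\<close>.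
  The pairs in \<open>\<Gamma>\<close> are the nowhere-zero flows over the Klein four-group, and Fourier inversion at
  every vertex turns a weighted sum over flows into a sum over vertex 4-colourings of a product of
  edge factors. For the trivial weight the edge factors are 3 or \<open>-1\<close>, over the Klein group as well as
  over the cyclic group, so \<open>|\<Gamma>| = F(G;4)\<close>. For the weight \<open>\<omega> ^ (|A| - |B|)\<close> the factor of an edge is
  0 if its ends have equal colours and twice a cube root of unity otherwise. On each triangle of
  a proper colouring these roots are \<open>1\<close>, \<open>\<omega>\<close>, \<open>\<omega>\<^sup>2\<close>, so by the double cover the square of
  their product over all edges is 1; being a cube root of unity, the product itself is 1, and every
  proper colouring contributes \<open>2 ^ |E|\<close>.
\<close>

section \<open>Weighted flow sums by Fourier inversion\<close>

text \<open>By \<open>conserved\<close>, summing over \<open>Y\<close> at a vertex detects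
  conservation there. Expanding the product of these detectors over \<open>V\<close> gives a sum
  over assignments \<open>p\<close> of an element of \<open>Y\<close> to each vertex; for fixed
  \<open>p\<close> the sum over \<open>f\<close> factors over edges. Two separate conditional
  factors let a loop contribute both its ends at one vertex.\<close>

lemma weighted_flow_sum:
  fixes \<alpha> \<beta> :: "'y \<Rightarrow> 'x \<Rightarrow> complex" and w :: "'x \<Rightarrow> complex"
  assumes fin: "finite V" "finite E" "finite Y" "finite X"
    and ends: "\<And>e. e \<in> E \<Longrightarrow> s e \<in> V" "\<And>e. e \<in> E \<Longrightarrow> t e \<in> V"
    and conserved: "\<And>f v. f \<in> E \<rightarrow>\<^sub>E X \<Longrightarrow> v \<in> V \<Longrightarrow>
      (\<Sum>y\<in>Y. \<Prod>e\<in>E. (if t e = v then \<alpha> y (f e) else 1) * (if s e = v then \<beta> y (f e) else 1)) =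
      (if C f v then q else 0)"
  shows "q ^ card V * (\<Sum>f\<in>{f \<in> E \<rightarrow>\<^sub>E X. \<forall>v\<in>V. C f v}. \<Prod>e\<in>E. w (f e)) =
    (\<Sum>p\<in>V \<rightarrow>\<^sub>E Y. \<Prod>e\<in>E. \<Sum>x\<in>X. w x * \<alpha> (p (t e)) x * \<beta> (p (s e)) x)"
proof -
  define \<kappa> where "\<kappa> v e y x =
    (if t e = v then \<alpha> y x else 1) * (if s e = v then \<beta> y x else 1)" for v e y x
  have finPi: "finite (E \<rightarrow>\<^sub>E X)" "finite (V \<rightarrow>\<^sub>E Y)"
    using fin by (auto intro: finite_PiE)
  \<comment> \<open>Each edge sees only the labels of its two ends.\<close>
  have \<kappa>_prod: "(\<Prod>v\<in>V. \<kappa> v e (p v) x) = \<alpha> (p (t e)) x * \<beta> (p (s e)) x"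
    if "e \<in> E" for e x and p :: "_ \<Rightarrow> 'y"
    using fin ends that by (simp add: \<kappa>_def prod.distrib prod.delta)
  have "q ^ card V * (\<Sum>f\<in>{f \<in> E \<rightarrow>\<^sub>E X. \<forall>v\<in>V. C f v}. \<Prod>e\<in>E. w (f e)) =
      (\<Sum>f\<in>E \<rightarrow>\<^sub>E X. if \<forall>v\<in>V. C f v then q ^ card V * (\<Prod>e\<in>E. w (f e)) else 0)"
    using finPi by (auto simp: sum.inter_filter sum_distrib_left intro!: sum.cong)
  also have "\<dots> = (\<Sum>f\<in>E \<rightarrow>\<^sub>E X. (\<Prod>v\<in>V. if C f v then q else 0) * (\<Prod>e\<in>E. w (f e)))"
  proof (intro sum.cong refl)
    fix f
    show "(if \<forall>v\<in>V. C f v then q ^ card V * (\<Prod>e\<in>E. w (f e)) else 0) =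
        (\<Prod>v\<in>V. if C f v then q else 0) * (\<Prod>e\<in>E. w (f e))"
      using fin by (auto simp: prod_zero)
  qed
  also have "\<dots> = (\<Sum>f\<in>E \<rightarrow>\<^sub>E X. (\<Prod>v\<in>V. \<Sum>y\<in>Y. \<Prod>e\<in>E. \<kappa> v e y (f e)) * (\<Prod>e\<in>E. w (f e)))"
    by (intro sum.cong arg_cong2[where f = "(*)"] prod.cong refl) (simp add: \<kappa>_def conserved)
  also have "\<dots> = (\<Sum>f\<in>E \<rightarrow>\<^sub>E X. \<Sum>p\<in>V \<rightarrow>\<^sub>E Y.
      (\<Prod>v\<in>V. \<Prod>e\<in>E. \<kappa> v e (p v) (f e)) * (\<Prod>e\<in>E. w (f e)))"
    using fin by (simp add: prod_sum_PiE sum_distrib_right)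
  also have "\<dots> = (\<Sum>p\<in>V \<rightarrow>\<^sub>E Y. \<Sum>f\<in>E \<rightarrow>\<^sub>E X.
      \<Prod>e\<in>E. w (f e) * \<alpha> (p (t e)) (f e) * \<beta> (p (s e)) (f e))"
  proof (subst sum.swap, intro sum.cong refl)
    fix p f
    have "(\<Prod>v\<in>V. \<Prod>e\<in>E. \<kappa> v e (p v) (f e)) = (\<Prod>e\<in>E. \<Prod>v\<in>V. \<kappa> v e (p v) (f e))"
      by (rule prod.swap)
    also have "\<dots> = (\<Prod>e\<in>E. \<alpha> (p (t e)) (f e) * \<beta> (p (s e)) (f e))"
      by (intro prod.cong refl \<kappa>_prod)
    finally show "(\<Prod>v\<in>V. \<Prod>e\<in>E. \<kappa> v e (p v) (f e)) * (\<Prod>e\<in>E. w (f e)) =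
        (\<Prod>e\<in>E. w (f e) * \<alpha> (p (t e)) (f e) * \<beta> (p (s e)) (f e))"
      by (simp add: prod.distrib mult_ac)
  qed
  also have "\<dots> = (\<Sum>p\<in>V \<rightarrow>\<^sub>E Y. \<Prod>e\<in>E. \<Sum>x\<in>X. w x * \<alpha> (p (t e)) x * \<beta> (p (s e)) x)"
    using fin by (simp add: prod_sum_PiE)
  finally show ?thesis .
qed

lemma sum_lessThan_4: "(\<Sum>i\<in>{0..<4::nat}. f i) = f 0 + f 1 + f 2 + (f 3 :: complex)"
  by (simp add: numeral_eq_Suc)

lemma atLeastLessThan_4: "{0..<4::nat} = {0, 1, 2, 3}"
  by auto

lemma finite_multigraphD:
  assumes "finite_multigraph G"
  shows "finite (verts G)" "finite (edges G)"
  using assms by (auto simp: finite_multigraph_def)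

lemma orientation_in_verts:
  assumes "finite_multigraph G" "orientation G src tgt" "e \<in> edges G"
  shows "src e \<in> verts G" "tgt e \<in> verts G"
  using assms by (auto simp: finite_multigraph_def orientation_def)

section \<open>Flows over the cyclic group of order four\<close>

text \<open>Orthogonality of the characters of the cyclic group of order 4. Since
  \<open>- \<i>\<close> is the inverse of \<open>\<i>\<close>, the base is \<open>\<i>\<close> to
  the power \<open>m - n\<close>, written without subtracting naturals.\<close>

lemma sum_powers_i:
  "(\<Sum>y\<in>{0..<4}. (\<i> ^ m * (- \<i>) ^ n) ^ y) = (if [m = n] (mod 4) then 4 else (0::complex))"
proof -
  have i4: "\<i> ^ 4 = 1" "(- \<i>) ^ 4 = 1"
    by (simp_all add: numeral_eq_Suc)
  have "z ^ k = z ^ (k mod 4)" if "z ^ 4 = 1" for z :: complex and k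
  proof -
    have "z ^ k = z ^ (4 * (k div 4) + k mod 4)"
      by simp
    also have "\<dots> = z ^ (k mod 4)"
      by (simp only: power_add power_mult that) simp
    finally show ?thesis .
  qed
  from this[OF i4(1), of m] this[OF i4(2), of n]
  have "\<i> ^ m = \<i> ^ (m mod 4)" "(- \<i>) ^ n = (- \<i>) ^ (n mod 4)" .
  moreover have "m mod 4 \<in> {0, 1, 2, 3}" "n mod 4 \<in> {0, 1, 2, 3}"
    by auto
  ultimately show ?thesis
    by (auto simp: sum_lessThan_4 cong_def power2_eq_square power3_eq_cube)
qed

text \<open>The edge factor sums a character, given by the difference of the end labels, over the
  nonzero residues. The full character sum is 4 or 0, and removing the residue 0 leaves 3 or
  -1.\<close>

lemma cyclic_flow_sum:
  assumes G: "finite_multigraph G" and o: "orientation G src tgt"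
  shows "4 ^ card (verts G) * of_nat (flow_count G src tgt 4) =
    (\<Sum>p\<in>verts G \<rightarrow>\<^sub>E {0..<4::nat}. \<Prod>e\<in>edges G. if p (tgt e) = p (src e) then 3 else - 1 :: complex)"
proof -
  let ?V = "verts G" and ?E = "edges G"
  let ?C = "\<lambda>f v. [(\<Sum>e | e \<in> ?E \<and> tgt e = v. f e) = (\<Sum>e | e \<in> ?E \<and> src e = v. f e)] (mod (4::nat))"
  let ?\<alpha> = "\<lambda>y x. (\<i> ^ x) ^ y" and ?\<beta> = "\<lambda>y x. ((- \<i>) ^ x) ^ y"
  note fin = finite_multigraphD[OF G]
  have "(\<Sum>y\<in>{0..<4}. \<Prod>e\<in>?E. (if tgt e = v then ?\<alpha> y (f e) else 1) * (if src e = v then ?\<beta> y (f e) else 1)) =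
      (if ?C f v then 4 else 0)" for f v
  proof -
    have "(\<Prod>e\<in>?E. (if tgt e = v then ?\<alpha> y (f e) else 1) * (if src e = v then ?\<beta> y (f e) else 1)) =
       (\<i> ^ (\<Sum>e | e \<in> ?E \<and> tgt e = v. f e) * (- \<i>) ^ (\<Sum>e | e \<in> ?E \<and> src e = v. f e)) ^ y" for y
      using fin
      by (simp add: prod.distrib power_sum power_mult_distrib prod_power_distrib flip: prod.inter_filter)
    then show ?thesis
      by (simp only: sum_powers_i)
  qed
  \<comment> \<open>Restricting the values to 1, 2, 3 builds the nowhere-zero condition into the
    function space.\<close>
  then have "4 ^ card ?V * (\<Sum>f\<in>{f \<in> ?E \<rightarrow>\<^sub>E {1, 2, 3}. \<forall>v\<in>?V. ?C f v}. \<Prod>e\<in>?E. 1) =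
      (\<Sum>p\<in>?V \<rightarrow>\<^sub>E {0..<4}. \<Prod>e\<in>?E. \<Sum>x\<in>{1, 2, 3}. 1 * ?\<alpha> (p (tgt e)) x * ?\<beta> (p (src e)) x)"
    by (intro weighted_flow_sum) (use fin orientation_in_verts[OF G o] in auto)
  also have "\<dots> = (\<Sum>p\<in>?V \<rightarrow>\<^sub>E {0..<4::nat}. \<Prod>e\<in>?E. if p (tgt e) = p (src e) then 3 else - 1)"
  proof (intro sum.cong prod.cong refl)
    fix p e assume "p \<in> ?V \<rightarrow>\<^sub>E {0..<4::nat}" "e \<in> ?E"
    then have "p (tgt e) \<in> {0, 1, 2, 3}" "p (src e) \<in> {0, 1, 2, 3}"
      using orientation_in_verts[OF G o, of e] atLeastLessThan_4 by blast+
    then show "(\<Sum>x\<in>{1, 2, 3}. 1 * ?\<alpha> (p (tgt e)) x * ?\<beta> (p (src e)) x) =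
        (if p (tgt e) = p (src e) then 3 else - 1)"
      by (elim insertE emptyE; simp add: power2_eq_square power3_eq_cube)
  qed
  also have "{f \<in> ?E \<rightarrow>\<^sub>E {1, 2, 3}. \<forall>v\<in>?V. ?C f v} = nowhere_zero_flows G src tgt 4"
  proof -
    have "f \<in> ?E \<rightarrow>\<^sub>E {1, 2, 3} \<longleftrightarrow> f \<in> ?E \<rightarrow>\<^sub>E {0..<4} \<and> (\<forall>e\<in>?E. f e \<noteq> 0)" for f :: "_ \<Rightarrow> nat"
      unfolding atLeastLessThan_4 PiE_iff by fastforce
    then show ?thesis
      by (auto simp: nowhere_zero_flows_def)
  qed
  finally show ?thesis
    by (simp add: flow_count_def)
qed

section \<open>Pairs of eulerian sets as flows over the Klein four-group\<close>

text \<open>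
  The character of the group \<open>bool \<times> bool\<close> indexed by \<open>y < 4\<close>, whose binary digits
  select the coordinates.
\<close>

definition klein_char :: "nat \<Rightarrow> bool \<times> bool \<Rightarrow> complex" where
  "klein_char y x = (if odd y \<and> fst x then - 1 else 1) * (if 2 \<le> y \<and> snd x then - 1 else 1)"

text \<open>The restriction to \<open>E\<close> makes the function extensional, so that pairs of
  edge sets correspond bijectively to elements of a \<open>PiE\<close> space.\<close>

definition edge_pair :: "'e set \<times> 'e set \<Rightarrow> 'e set \<Rightarrow> 'e \<Rightarrow> bool \<times> bool" where
  "edge_pair P E = (\<lambda>e\<in>E. (e \<in> fst P, e \<in> snd P))"

text \<open>Each end of an edge at \<open>v\<close> contributes a sign; a loop contributes two, in
  agreement with its double count in the degree.\<close>

lemma parity_degree_in: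
  assumes o: "orientation G src tgt" and A: "A \<subseteq> edges G" "finite A"
  shows "(- 1) ^ degree_in G A v =
    (\<Prod>e\<in>A. (if tgt e = v then - 1 else 1) * (if src e = v then - 1 else 1) :: complex)"
proof -
  have ends: "ends G e = Upair (src e) (tgt e)" if "e \<in> A" for e
    using o A that by (auto simp: orientation_def)
  have "{e \<in> A. v \<in> set_uprod (ends G e)} = {e \<in> A. tgt e = v \<or> src e = v}"
    "{e \<in> A. ends G e = Upair v v} = {e \<in> A. tgt e = v \<and> src e = v}"
    using ends by auto
  then have "degree_in G A v = card {e \<in> A. tgt e = v \<or> src e = v} + card {e \<in> A. tgt e = v \<and> src e = v}"
    by (simp add: degree_in_def)
  then have "(- 1 :: complex) ^ degree_in G A v =
      (\<Prod>e\<in>{e \<in> A. tgt e = v \<or> src e = v}. - 1) * (\<Prod>e\<in>{e \<in> A. tgt e = v \<and> src e = v}. - 1)"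
    by (simp add: power_add)
  also have "\<dots> = (\<Prod>e\<in>A. (if tgt e = v \<or> src e = v then - 1 else 1) * (if tgt e = v \<and> src e = v then - 1 else 1))"
    using A by (simp only: prod.inter_filter prod.distrib)
  \<comment> \<open>The number of ends at \<open>v\<close> is the indicator of "at least one" plus
    the indicator of "both".\<close>
  also have "\<dots> = (\<Prod>e\<in>A. (if tgt e = v then - 1 else 1) * (if src e = v then - 1 else 1))"
    by (intro prod.cong) auto
  finally show ?thesis .
qed

text \<open>With \<open>s\<close> and \<open>t\<close> the signs of the two degree parities, the
  four characters give 1, \<open>s\<close>, \<open>t\<close>, \<open>s * t\<close>, whose sum
  \<open>(1 + s) * (1 + t)\<close> is 4 or 0. Elements of the Klein group are their own inverses, so
  the same character serves at both ends.\<close>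

lemma klein_conservation:
  fixes f :: "'e \<Rightarrow> bool \<times> bool"
  assumes G: "finite_multigraph G" and o: "orientation G src tgt"
  shows "(\<Sum>y\<in>{0..<4}. \<Prod>e\<in>edges G. (if tgt e = v then klein_char y (f e) else 1) *
      (if src e = v then klein_char y (f e) else 1)) =
    (if even (degree_in G {e \<in> edges G. fst (f e)} v) \<and> even (degree_in G {e \<in> edges G. snd (f e)} v)
      then 4 else 0)"
proof -
  let ?E = "edges G"
  let ?m = "\<lambda>e. (if tgt e = v then - 1 else 1) * (if src e = v then - 1 else 1) :: complex"
  note fin = finite_multigraphD[OF G]
  have parity: "(- 1) ^ degree_in G {e \<in> ?E. P e} v = (\<Prod>e\<in>?E. if P e then ?m e else 1)" for P
    using fin by (subst parity_degree_in[OF o]) (auto simp: prod.inter_filter)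
  have "(\<Prod>e\<in>?E. (if tgt e = v then klein_char y (f e) else 1) * (if src e = v then klein_char y (f e) else 1)) =
      (if odd y then (- 1) ^ degree_in G {e \<in> ?E. fst (f e)} v else 1) *
      (if 2 \<le> y then (- 1) ^ degree_in G {e \<in> ?E. snd (f e)} v else 1)" for y
  proof -
    have "(\<Prod>e\<in>?E. (if tgt e = v then klein_char y (f e) else 1) * (if src e = v then klein_char y (f e) else 1)) =
        (\<Prod>e\<in>?E. (if odd y then if fst (f e) then ?m e else 1 else 1) *
          (if 2 \<le> y then if snd (f e) then ?m e else 1 else 1))"
      by (intro prod.cong) (auto simp: klein_char_def)
    then show ?thesis
      by (simp add: prod.distrib parity)
  qed
  then show ?thesis
    by (simp add: sum_lessThan_4 uminus_power_if)
qed

text \<open>Taken coordinatewise, being eulerian is conservation modulo 2, and covering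
  \<open>E\<close> means that \<open>(False, False)\<close> is never a value; hence its absence from
  \<open>X\<close>.\<close>

lemma eulerian_cover_sum:
  fixes w :: "bool \<times> bool \<Rightarrow> complex"
  assumes G: "finite_multigraph G" and o: "orientation G src tgt"
  defines "X \<equiv> {(True, False), (False, True), (True, True)}"
  shows "4 ^ card (verts G) * (\<Sum>P\<in>Collect (eulerian_cover G). \<Prod>e\<in>edges G. w (e \<in> fst P, e \<in> snd P)) =
    (\<Sum>p\<in>verts G \<rightarrow>\<^sub>E {0..<4}. \<Prod>e\<in>edges G. \<Sum>x\<in>X. w x * klein_char (p (tgt e)) x * klein_char (p (src e)) x)"
proof -
  let ?V = "verts G" and ?E = "edges G"
  let ?C = "\<lambda>f v. even (degree_in G {e \<in> ?E. fst (f e)} v) \<and> even (degree_in G {e \<in> ?E. snd (f e)} v)"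
  note fin = finite_multigraphD[OF G]
  have "(\<Sum>P\<in>Collect (eulerian_cover G). \<Prod>e\<in>?E. w (e \<in> fst P, e \<in> snd P)) =
      (\<Sum>f\<in>{f \<in> ?E \<rightarrow>\<^sub>E X. \<forall>v\<in>?V. ?C f v}. \<Prod>e\<in>?E. w (f e))"
  proof (rule sum.reindex_bij_witness[where j = "\<lambda>P. edge_pair P ?E"
        and i = "\<lambda>f. ({e \<in> ?E. fst (f e)}, {e \<in> ?E. snd (f e)})"])
    fix P assume "P \<in> Collect (eulerian_cover G)"
    then have P: "eulerian G (fst P)" "eulerian G (snd P)" "fst P \<union> snd P = ?E"
      by (auto simp: eulerian_cover_def split: prod.splits)
    have sets: "{e \<in> ?E. fst (edge_pair P ?E e)} = fst P" "{e \<in> ?E. snd (edge_pair P ?E e)} = snd P"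
      using P by (auto simp: edge_pair_def)
    show "({e \<in> ?E. fst (edge_pair P ?E e)}, {e \<in> ?E. snd (edge_pair P ?E e)}) = P"
      by (simp add: sets)
    show "edge_pair P ?E \<in> {f \<in> ?E \<rightarrow>\<^sub>E X. \<forall>v\<in>?V. ?C f v}"
      unfolding mem_Collect_eq sets
      using P by (auto simp: edge_pair_def X_def eulerian_def)
    show "(\<Prod>e\<in>?E. w (edge_pair P ?E e)) = (\<Prod>e\<in>?E. w (e \<in> fst P, e \<in> snd P))"
      by (simp add: edge_pair_def)
  next
    fix f assume f: "f \<in> {f \<in> ?E \<rightarrow>\<^sub>E X. \<forall>v\<in>?V. ?C f v}"
    show "edge_pair ({e \<in> ?E. fst (f e)}, {e \<in> ?E. snd (f e)}) ?E = f"
      using f by (auto simp: edge_pair_def fun_eq_iff PiE_iff extensional_def)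
    have "f e \<in> X" if "e \<in> ?E" for e
      using f that by auto
    then have "fst (f e) \<or> snd (f e)" if "e \<in> ?E" for e
      using that by (fastforce simp: X_def)
    then show "({e \<in> ?E. fst (f e)}, {e \<in> ?E. snd (f e)}) \<in> Collect (eulerian_cover G)"
      using f by (auto simp: eulerian_cover_def eulerian_def)
  qed
  moreover have "4 ^ card ?V * (\<Sum>f\<in>{f \<in> ?E \<rightarrow>\<^sub>E X. \<forall>v\<in>?V. ?C f v}. \<Prod>e\<in>?E. w (f e)) =
      (\<Sum>p\<in>?V \<rightarrow>\<^sub>E {0..<4}. \<Prod>e\<in>?E. \<Sum>x\<in>X. w x * klein_char (p (tgt e)) x * klein_char (p (src e)) x)"
    by (intro weighted_flow_sum)
      (use fin orientation_in_verts[OF G o] klein_conservation[OF G o] in \<open>auto simp: X_def\<close>)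
  ultimately show ?thesis
    by simp
qed

text \<open>No bijection with cyclic flows is built: both Fourier sums run over the same labels
  \<open>{0..<4}\<close>, and their edge factors depend only on whether the end labels
  agree.\<close>

lemma card_eulerian_cover:
  assumes G: "finite_multigraph G" and o: "orientation G src tgt"
  shows "card (Collect (eulerian_cover G)) = flow_count G src tgt 4"
proof -
  let ?X = "{(True, False), (False, True), (True, True)}"
  have "4 ^ card (verts G) * (\<Sum>P\<in>Collect (eulerian_cover G). \<Prod>e\<in>edges G. 1) =
      (\<Sum>p\<in>verts G \<rightarrow>\<^sub>E {0..<4}. \<Prod>e\<in>edges G.
        \<Sum>x\<in>?X. 1 * klein_char (p (tgt e)) x * klein_char (p (src e)) x)"
    by (rule eulerian_cover_sum[OF G o])
  also have "\<dots> = (\<Sum>p\<in>verts G \<rightarrow>\<^sub>E {0..<4::nat}. \<Prod>e\<in>edges G. if p (tgt e) = p (src e) then 3 else - 1)"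
  proof (intro sum.cong prod.cong refl)
    fix p e assume "p \<in> verts G \<rightarrow>\<^sub>E {0..<4::nat}" "e \<in> edges G"
    then have "p (tgt e) \<in> {0, 1, 2, 3}" "p (src e) \<in> {0, 1, 2, 3}"
      using orientation_in_verts[OF G o, of e] atLeastLessThan_4 by blast+
    then show "(\<Sum>x\<in>?X. 1 * klein_char (p (tgt e)) x * klein_char (p (src e)) x) =
        (if p (tgt e) = p (src e) then 3 else - 1)"
      by (elim insertE emptyE; simp add: klein_char_def)
  qed
  also have "\<dots> = 4 ^ card (verts G) * of_nat (flow_count G src tgt 4)"
    by (rule cyclic_flow_sum[OF G o, symmetric])
  finally have "(of_nat (card (Collect (eulerian_cover G))) :: complex) = of_nat (flow_count G src tgt 4)"
    by simp
  then show ?thesis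
    by (simp only: of_nat_eq_iff)
qed

section \<open>Colourings and triangle double covers\<close>

definition \<omega> :: complex where
  "\<omega> = Complex (- 1 / 2) (sqrt 3 / 2)"

lemma \<omega>_square: "\<omega> ^ 2 = - 1 - \<omega>"
  by (simp add: \<omega>_def complex_eq_iff power2_eq_square)

text \<open>Rewrite rules that lower the degree in \<open>\<omega>\<close>; the second handles
  right-nested products.\<close>

lemma \<omega>_products: "\<omega> * \<omega> = - 1 - \<omega>" "\<omega> * (\<omega> * z) = - z - \<omega> * z"
proof -
  show "\<omega> * \<omega> = - 1 - \<omega>"
    using \<omega>_square by (simp only: power2_eq_square)
  then show "\<omega> * (\<omega> * z) = - z - \<omega> * z"
    by (simp only: mult.assoc[symmetric]) (simp add: left_diff_distrib)
qed

lemma \<omega>_cube: "\<omega> ^ 3 = 1"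
  by (simp add: power3_eq_cube \<omega>_products left_diff_distrib)

lemma \<omega>_power_mod: "\<omega> ^ n = \<omega> ^ (n mod 3)"
proof -
  have "\<omega> ^ n = \<omega> ^ (3 * (n div 3) + n mod 3)"
    by simp
  also have "\<dots> = \<omega> ^ (n mod 3)"
    by (simp only: power_add power_mult \<omega>_cube) simp
  finally show ?thesis .
qed

text \<open>Here \<open>\<omega> ^ 2\<close> stands for the inverse of \<open>\<omega>\<close>, so
  the product over all edges is \<open>\<omega>\<close> to the power \<open>|A| - |B|\<close> with a
  natural exponent.\<close>

definition \<omega>_weight :: "bool \<times> bool \<Rightarrow> complex" where
  "\<omega>_weight x = (if fst x then \<omega> else 1) * (if snd x then \<omega> ^ 2 else 1)"

text \<open>Half of the Fourier transform of \<open>\<omega>_weight\<close> on nonzero elements, at the difference of two colours.\<close>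

definition colour_weight :: "nat \<Rightarrow> nat \<Rightarrow> complex" where
  "colour_weight y z = (\<Sum>x\<in>{(True, False), (False, True), (True, True)}.
     \<omega>_weight x * klein_char y x * klein_char z x) / 2"

lemma colour_weight_commute: "colour_weight y z = colour_weight z y"
  by (simp add: colour_weight_def mult_ac)

lemma \<omega>_weight_values:
  "\<omega>_weight (True, False) = \<omega>" "\<omega>_weight (False, True) = - 1 - \<omega>" "\<omega>_weight (True, True) = 1"
  by (simp_all add: \<omega>_weight_def power2_eq_square \<omega>_products right_diff_distrib)

text \<open>For distinct colours the bitwise difference decides the value, and the sum
  \<open>y + z\<close> identifies it: 1 or 5 means difference 1, 3 means difference 3, and 2 or 4
  means difference 2.\<close>

lemma colour_weight_values:
  assumes "y \<in> {0, 1, 2, 3}" "z \<in> {0, 1, 2, 3}"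
  shows "colour_weight y z =
    (if y = z then 0 else if y + z = 1 \<or> y + z = 5 then \<omega> ^ 2 else if y + z = 3 then 1 else \<omega>)"
  using assms
  by (elim insertE emptyE; simp add: colour_weight_def \<omega>_weight_values klein_char_def \<omega>_square)

lemma colour_weight_refl: "y \<in> {0, 1, 2, 3} \<Longrightarrow> colour_weight y y = 0"
  by (simp add: colour_weight_values)

lemma colour_weight_cube:
  assumes "y \<in> {0, 1, 2, 3}" "z \<in> {0, 1, 2, 3}" "y \<noteq> z"
  shows "colour_weight y z ^ 3 = 1"
proof -
  have "(\<omega> ^ 2) ^ 3 = (\<omega> ^ 3) ^ 2"
    by (simp only: power_mult[symmetric] mult.commute)
  then have "(\<omega> ^ 2) ^ 3 = 1"
    by (simp only: \<omega>_cube power_one)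
  then show ?thesis
    unfolding colour_weight_values[OF assms(1,2)]
    using assms(3) \<omega>_cube by (simp del: power_mult_numeral)
qed

text \<open>The pairwise differences of three distinct elements of the Klein group are its nonzero elements.\<close>

lemma colour_weight_triangle:
  assumes "y \<in> {0, 1, 2, 3}" "z \<in> {0, 1, 2, 3}" "x \<in> {0, 1, 2, 3}" "y \<noteq> z" "z \<noteq> x" "x \<noteq> y"
  shows "colour_weight y z * colour_weight z x * colour_weight x y = 1"
proof -
  have "\<omega> * \<omega> ^ 2 = 1" "\<omega> ^ 2 * \<omega> = 1"
    using \<omega>_cube by (simp_all only: power3_eq_cube power2_eq_square mult.assoc)
  then show ?thesis
    unfolding colour_weight_values[OF assms(1,2)] colour_weight_values[OF assms(2,3)]
      colour_weight_values[OF assms(3,1)]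
    using assms by (elim insertE emptyE) simp_all
qed

text \<open>Double counting: the factor of \<open>e\<close> occurs once for each member of
  \<open>C\<close> containing \<open>e\<close>, with multiplicity.\<close>

lemma prod_mset_prod_eq:
  fixes u :: "'a \<Rightarrow> 'b::comm_monoid_mult"
  assumes "finite E" "\<forall>T\<in>#C. T \<subseteq> E"
  shows "(\<Prod>T\<in>#C. \<Prod>e\<in>T. u e) = (\<Prod>e\<in>E. u e ^ size {#T \<in># C. e \<in> T#})"
  using assms(2)
proof (induction C)
  case (add T C)
  have "(\<Prod>e\<in>T. u e) = (\<Prod>e\<in>E. if e \<in> T then u e else 1)"
    using add.prems assms(1) by (simp add: prod.If_cases Int_absorb1)
  then have "(\<Prod>T\<in>#add_mset T C. \<Prod>e\<in>T. u e) =
      (\<Prod>e\<in>E. (if e \<in> T then u e else 1) * u e ^ size {#T \<in># C. e \<in> T#})"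
    using add by (simp add: prod.distrib)
  also have "\<dots> = (\<Prod>e\<in>E. u e ^ size {#T \<in># add_mset T C. e \<in> T#})"
    by (intro prod.cong) auto
  finally show ?case .
qed simp

lemma proper_colouring_weight:
  assumes G: "finite_multigraph G" and o: "orientation G src tgt" and C: "triangle_double_cover G C"
    and p: "p \<in> proper_colourings G 4"
  shows "(\<Prod>e\<in>edges G. colour_weight (p (tgt e)) (p (src e))) = 1"
proof -
  let ?u = "\<lambda>e. colour_weight (p (tgt e)) (p (src e))"
  have range: "p v \<in> {0, 1, 2, 3}" if "v \<in> verts G" for v
    using p that unfolding proper_colourings_def atLeastLessThan_4 by blast
  have proper: "p u \<noteq> p v" if "e \<in> edges G" "ends G e = Upair u v" for e u v
    using p that by (auto simp: proper_colourings_def)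
  \<comment> \<open>The order in which a triangle names the ends of an edge may disagree with the
    orientation; symmetry of \<open>colour_weight\<close> absorbs this.\<close>
  have weight: "?u e = colour_weight (p u) (p v) \<and> u \<in> verts G \<and> v \<in> verts G"
    if "e \<in> edges G" "ends G e = Upair u v" for e u v
  proof -
    have "Upair u v = Upair (src e) (tgt e)"
      using o that unfolding orientation_def by metis
    then have "u = src e \<and> v = tgt e \<or> u = tgt e \<and> v = src e"
      by (metis Upair_inject)
    then show ?thesis
      using orientation_in_verts[OF G o that(1)] colour_weight_commute by auto
  qed
  have "(\<Prod>e\<in>edges G. ?u e) ^ 3 = 1"
  proof -
    have "?u e ^ 3 = 1" if "e \<in> edges G" for e
      using that o orientation_in_verts[OF G o that] proper[OF that, of "tgt e" "src e"]
      by (intro colour_weight_cube range) (auto simp: orientation_def)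
    then show ?thesis
      by (simp add: prod_power_distrib)
  qed
  moreover have "(\<Prod>e\<in>edges G. ?u e) ^ 2 = 1"
  proof -
    have triangles: "\<forall>T\<in>#C. triangle G T" and twice: "\<forall>e\<in>edges G. size {#T \<in># C. e \<in> T#} = 2"
      using C by (auto simp: triangle_double_cover_def)
    have "(\<Prod>e\<in>edges G. ?u e) ^ 2 = (\<Prod>e\<in>edges G. ?u e ^ size {#T \<in># C. e \<in> T#})"
      using twice by (simp add: prod_power_distrib)
    also have "\<dots> = (\<Prod>T\<in>#C. \<Prod>e\<in>T. ?u e)"
    proof (rule prod_mset_prod_eq[symmetric])
      have "T \<subseteq> edges G" if "triangle G T" for T
        using that by (auto simp: triangle_def)
      then show "\<forall>T\<in>#C. T \<subseteq> edges G"
        using triangles by blast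
    qed (rule finite_multigraphD[OF G])
    also have "\<dots> = (\<Prod>T\<in>#C. 1)"
    proof (rule arg_cong[where f = prod_mset], rule image_mset_cong)
      fix T assume "T \<in># C"
      then have "triangle G T"
        using triangles by blast
      then obtain u v w e1 e2 e3 where
        uvw: "u \<noteq> v" "v \<noteq> w" "w \<noteq> u" and
        e: "e1 \<in> edges G" "e2 \<in> edges G" "e3 \<in> edges G" and
        ends: "ends G e1 = Upair u v" "ends G e2 = Upair v w" "ends G e3 = Upair w u" and
        T: "T = {e1, e2, e3}"
        unfolding triangle_def by (elim exE conjE)
      \<comment> \<open>Distinctness ensures that the product over the set \<open>T\<close> really
        has three factors.\<close>
      have "e1 \<noteq> e2" "e2 \<noteq> e3" "e1 \<noteq> e3"
        using ends uvw by auto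
      then have "(\<Prod>e\<in>T. ?u e) = ?u e1 * ?u e2 * ?u e3"
        by (simp add: T mult.assoc)
      also have "\<dots> = colour_weight (p u) (p v) * colour_weight (p v) (p w) * colour_weight (p w) (p u)"
        using weight e ends by metis
      also have "\<dots> = 1"
        using weight e ends proper by (intro colour_weight_triangle range) metis+
      finally show "(\<Prod>e\<in>T. ?u e) = 1" .
    qed
    finally show ?thesis
      by simp
  qed
  \<comment> \<open>A number whose cube and square are both 1 is 1.\<close>
  ultimately show ?thesis
    by (simp add: power3_eq_cube power2_eq_square)
qed

lemma sum_\<omega>_eulerian_cover:
  assumes G: "finite_multigraph G" and o: "orientation G src tgt" and C: "triangle_double_cover G C"
  shows "4 ^ card (verts G) * (\<Sum>(A, B)\<in>Collect (eulerian_cover G). \<omega> ^ (card A + 2 * card B)) =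
    2 ^ card (edges G) * of_nat (chromatic_count G 4)"
proof -
  let ?V = "verts G" and ?E = "edges G"
  let ?u = "\<lambda>p e. colour_weight (p (tgt e)) (p (src e))"
  note fin = finite_multigraphD[OF G]
  have "(\<Prod>e\<in>?E. \<omega>_weight (e \<in> A, e \<in> B)) = \<omega> ^ (card A + 2 * card B)"
    if "A \<subseteq> ?E" "B \<subseteq> ?E" for A B
    using fin that
    by (simp add: \<omega>_weight_def prod.distrib prod.If_cases Int_absorb1 power_add power_mult)
  then have "(\<Sum>(A, B)\<in>Collect (eulerian_cover G). \<omega> ^ (card A + 2 * card B)) =
      (\<Sum>P\<in>Collect (eulerian_cover G). \<Prod>e\<in>?E. \<omega>_weight (e \<in> fst P, e \<in> snd P))"
    by (intro sum.cong) (auto simp: eulerian_cover_def eulerian_def)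
  \<comment> \<open>This undoes the halving in \<open>colour_weight\<close>: every edge releases a
    factor 2.\<close>
  moreover have half: "2 * (S / 2) = S" for S :: complex
    by simp
  ultimately have "4 ^ card ?V * (\<Sum>(A, B)\<in>Collect (eulerian_cover G). \<omega> ^ (card A + 2 * card B)) =
      (\<Sum>p\<in>?V \<rightarrow>\<^sub>E {0..<4}. \<Prod>e\<in>?E. 2 * ?u p e)"
    by (simp only: eulerian_cover_sum[OF G o] colour_weight_def half)
  also have "\<dots> = 2 ^ card ?E * (\<Sum>p\<in>?V \<rightarrow>\<^sub>E {0..<4}. \<Prod>e\<in>?E. ?u p e)"
    by (simp add: prod.distrib sum_distrib_left)
  also have "(\<Sum>p\<in>?V \<rightarrow>\<^sub>E {0..<4}. \<Prod>e\<in>?E. ?u p e) = (\<Sum>p\<in>proper_colourings G 4. \<Prod>e\<in>?E. ?u p e)"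
  proof (rule sum.mono_neutral_right)
    show "finite (?V \<rightarrow>\<^sub>E {0..<4::nat})"
      using fin by (auto intro: finite_PiE)
    show "proper_colourings G 4 \<subseteq> ?V \<rightarrow>\<^sub>E {0..<4}"
      by (auto simp: proper_colourings_def)
    \<comment> \<open>A monochromatic edge has factor \<open>1 + \<omega> + \<omega> ^ 2 = 0\<close>
      (up to halving), which kills every improper colouring.\<close>
    show "\<forall>p\<in>(?V \<rightarrow>\<^sub>E {0..<4}) - proper_colourings G 4. (\<Prod>e\<in>?E. ?u p e) = 0"
    proof
      fix p assume p: "p \<in> (?V \<rightarrow>\<^sub>E {0..<4}) - proper_colourings G 4"
      then obtain e u v where e: "e \<in> ?E" "ends G e = Upair u v" "p u = p v"
        by (auto simp: proper_colourings_def)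
      then have "p (tgt e) = p (src e)"
        using o by (auto simp: orientation_def)
      moreover have "p (src e) \<in> {0, 1, 2, 3}"
        using p orientation_in_verts[OF G o e(1)] atLeastLessThan_4 by blast
      ultimately have "?u p e = 0"
        using colour_weight_refl by simp
      then show "(\<Prod>e\<in>?E. ?u p e) = 0"
        using fin e by (auto intro: prod_zero)
    qed
  qed
  also have "\<dots> = of_nat (chromatic_count G 4)"
    using proper_colouring_weight[OF G o C] by (simp add: chromatic_count_def)
  finally show ?thesis .
qed

section \<open>Biases as character sums\<close>

text \<open>
  Swapping the two sets exchanges the residues 1 and 2 of \<open>|A| - |B|\<close>, and
  \<open>\<omega> + \<omega>\<^sup>2 = - 1\<close>.
\<close>

lemma symmetric_card_shift:
  fixes S :: "('e set \<times> 'e set) set"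
  assumes fin: "finite S" and sym: "\<forall>P\<in>S. prod.swap P \<in> S"
  shows "card {P \<in> S. card_shift 1 P} = card {P \<in> S. card_shift 2 P}"
    and "(\<Sum>(A, B)\<in>S. \<omega> ^ (card A + 2 * card B)) =
      of_nat (card {P \<in> S. card_shift 0 P}) - of_nat (card {P \<in> S. card_shift 1 P})"
proof -
  have sym': "(B, A) \<in> S" if "(A, B) \<in> S" for A B
    using bspec[OF sym that] by simp
  show eq: "card {P \<in> S. card_shift 1 P} = card {P \<in> S. card_shift 2 P}"
  proof (rule bij_betw_same_card)
    have "[a = b + 1] (mod 3) \<longleftrightarrow> [b = a + 2] (mod 3)" for a b :: nat
    proof -
      have "[a = b + 1] (mod 3) \<longleftrightarrow> [a + 2 = b + 1 + 2] (mod 3)"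
        by (simp only: cong_add_rcancel_nat)
      then show ?thesis
        by (auto simp: cong_def)
    qed
    then have "card_shift 1 P \<longleftrightarrow> card_shift 2 (prod.swap P)" for P :: "'e set \<times> 'e set"
      by (cases P) (simp only: card_shift_def prod.case swap_simp)
    then show "bij_betw prod.swap {P \<in> S. card_shift 1 P} {P \<in> S. card_shift 2 P}"
      by (intro bij_betw_byWitness[where f' = prod.swap]) (auto intro: sym')
  qed
  have val: "\<omega> ^ (card A + 2 * card B) =
      (if card_shift 0 (A, B) then 1 else 0) + (if card_shift 1 (A, B) then \<omega> else 0) +
      (if card_shift 2 (A, B) then \<omega> ^ 2 else 0)" for A B :: "'e set"
  proof -
    let ?r = "(card A + 2 * card B) mod 3"
    \<comment> \<open>Adding \<open>2 * card B\<close> to both sides turns \<open>card B\<close>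
      into a multiple of 3 on the right.\<close>
    have shift: "card_shift k (A, B) \<longleftrightarrow> ?r = k mod 3" for k
    proof -
      have "card_shift k (A, B) \<longleftrightarrow> [card A + 2 * card B = card B + k + 2 * card B] (mod 3)"
        by (simp only: card_shift_def prod.case cong_add_rcancel_nat)
      also have "card B + k + 2 * card B = k + 3 * card B"
        by simp
      finally show ?thesis
        by (simp only: cong_def mod_mult_self2)
    qed
    have "?r = 0 \<or> ?r = 1 \<or> ?r = 2"
      by linarith
    then show ?thesis
      unfolding shift \<omega>_power_mod[of "card A + 2 * card B"] by (elim disjE) simp_all
  qed
  have "(\<Sum>(A, B)\<in>S. \<omega> ^ (card A + 2 * card B)) =
      (\<Sum>P\<in>S. (if card_shift 0 P then 1 else 0) + (if card_shift 1 P then \<omega> else 0) +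
        (if card_shift 2 P then \<omega> ^ 2 else 0))"
    by (intro sum.cong refl) (simp only: split_paired_all val prod.case)
  also have "\<dots> = of_nat (card {P \<in> S. card_shift 0 P}) + of_nat (card {P \<in> S. card_shift 1 P}) * \<omega> +
      of_nat (card {P \<in> S. card_shift 2 P}) * \<omega> ^ 2"
    using fin by (simp add: sum.distrib flip: sum.inter_filter)
  also have "\<dots> = of_nat (card {P \<in> S. card_shift 0 P}) - of_nat (card {P \<in> S. card_shift 1 P})"
    unfolding eq[symmetric] \<omega>_square by (simp add: algebra_simps)
  finally show "(\<Sum>(A, B)\<in>S. \<omega> ^ (card A + 2 * card B)) =
      of_nat (card {P \<in> S. card_shift 0 P}) - of_nat (card {P \<in> S. card_shift 1 P})" .
qed

text \<open>Expanding the product of \<open>z + 1\<close> over \<open>E\<close> chooses a subset of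
  \<open>E\<close>.\<close>

lemma sum_power_card_Pow:
  fixes z :: complex
  assumes "finite E"
  shows "(\<Sum>A\<in>Pow E. z ^ card A) = (1 + z) ^ card E"
  using prod_add[OF assms, of "\<lambda>_. z" "\<lambda>_. 1"] by (simp add: add.commute)

text \<open>The sum factors over \<open>A\<close> and \<open>B\<close>, and
  \<open>1 + \<omega> = - \<omega> ^ 2\<close> and \<open>1 + \<omega> ^ 2 = - \<omega>\<close> have
  product \<open>\<omega> ^ 3 = 1\<close>.\<close>

lemma sum_\<omega>_all_pairs:
  assumes "finite E"
  shows "(\<Sum>(A, B)\<in>Pow E \<times> Pow E. \<omega> ^ (card A + 2 * card B)) = 1"
proof -
  have "(\<Sum>(A, B)\<in>Pow E \<times> Pow E. \<omega> ^ (card A + 2 * card B)) =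
      (\<Sum>A\<in>Pow E. \<omega> ^ card A) * (\<Sum>B\<in>Pow E. (\<omega> ^ 2) ^ card B)"
    by (simp add: sum_product sum.cartesian_product power_add power_mult)
  also have "\<dots> = ((1 + \<omega>) * (1 + \<omega> ^ 2)) ^ card E"
    by (simp only: sum_power_card_Pow[OF assms] power_mult_distrib)
  also have "(1 + \<omega>) * (1 + \<omega> ^ 2) = 1"
    unfolding \<omega>_square by (simp add: algebra_simps \<omega>_products)
  finally show ?thesis
    by simp
qed

section \<open>Probabilities and biases as cardinalities\<close>

lemma prob_random_edge_sets:
  assumes "finite (edges G)"
  shows "measure_pmf.prob (random_edge_sets G) S =
    card ((Pow (edges G) \<times> Pow (edges G)) \<inter> S) / 4 ^ card (edges G)"
proof -
  let ?P = "Pow (edges G)"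
  have ne: "?P \<noteq> {}" "finite ?P" "?P \<times> ?P \<noteq> {}" "finite (?P \<times> ?P)"
    using assms by auto
  have "random_edge_sets G = pmf_of_set (?P \<times> ?P)"
    unfolding random_edge_sets_def
    by (rule pmf_eqI) (clarsimp simp: pmf_pair pmf_of_set[OF ne(1,2)] pmf_of_set[OF ne(3,4)]
        card_cartesian_product indicator_def)
  moreover have "card (?P \<times> ?P) = 4 ^ card (edges G)"
    using assms by (simp add: card_cartesian_product card_Pow flip: power_mult_distrib)
  ultimately show ?thesis
    using ne by (simp add: measure_pmf_of_set)
qed

lemma bias_card_shift:
  assumes "finite (edges G)"
  shows "bias (random_edge_sets G) (card_shift k) =
    2 * card {P \<in> Pow (edges G) \<times> Pow (edges G). card_shift k P} / 4 ^ card (edges G) - 1"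
proof -
  have "measure_pmf.prob (random_edge_sets G) {x. \<not> card_shift k x} =
      1 - measure_pmf.prob (random_edge_sets G) {x. card_shift k x}"
    by (subst measure_pmf.prob_compl[symmetric]) (auto intro: arg_cong[where f = "measure_pmf.prob _"])
  then show ?thesis
    using prob_random_edge_sets[OF assms, of "{x. card_shift k x}"]
    by (simp add: bias_def Int_def)
qed

text \<open>If the conditioning event is empty, division by zero makes the left side 0 but the right
  side -1, hence the assumption \<open>pos\<close>.\<close>

lemma cond_bias_card_shift:
  assumes "finite (edges G)" and pos: "card (Collect (eulerian_cover G)) \<noteq> 0"
  shows "cond_bias (random_edge_sets G) (card_shift k) (eulerian_cover G) =
    2 * card {P \<in> Collect (eulerian_cover G). card_shift k P} / card (Collect (eulerian_cover G)) - 1"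
proof -
  let ?N = "Collect (eulerian_cover G)"
  have "?N \<subseteq> Pow (edges G) \<times> Pow (edges G)"
    by (auto simp: eulerian_cover_def eulerian_def)
  then have inter: "(Pow (edges G) \<times> Pow (edges G)) \<inter> {x. Q x \<and> eulerian_cover G x} = {P \<in> ?N. Q P}"
    "(Pow (edges G) \<times> Pow (edges G)) \<inter> ?N = ?N" for Q
    by auto
  have cond: "cond_prob (measure_pmf (random_edge_sets G)) Q (eulerian_cover G) = real (card {P \<in> ?N. Q P}) / real (card ?N)" for Q
    by (simp add: cond_prob_def prob_random_edge_sets[OF assms(1)] inter)
  have "finite ?N"
    using pos card_ge_0_finite by blast
  then have "card ?N = card {P \<in> ?N. card_shift k P} + card {P \<in> ?N. \<not> card_shift k P}"
    by (subst card_Un_disjoint[symmetric]) (auto intro: arg_cong[where f = card])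
  then have not_shift: "real (card {P \<in> ?N. \<not> card_shift k P}) = real (card ?N) - real (card {P \<in> ?N. card_shift k P})"
    by simp
  then show ?thesis
    using pos by (simp only: cond_bias_def cond not_shift) (simp add: diff_divide_distrib)
qed

theorem theorem4p2:
  fixes G :: "('v, 'e) multigraph"
    and src tgt :: "'e \<Rightarrow> 'v"
  assumes "finite_multigraph G"
    and "\<exists>C. triangle_double_cover G C"
    and "orientation G src tgt"
  shows
    "cond_bias (random_edge_sets G) (card_shift 1) (eulerian_cover G) =
       cond_bias (random_edge_sets G) (card_shift 2) (eulerian_cover G) \<and>
     (cond_bias (random_edge_sets G) (card_shift 0) (eulerian_cover G) -
        cond_bias (random_edge_sets G) (card_shift 1) (eulerian_cover G)) /
       (bias (random_edge_sets G) (card_shift 0) - bias (random_edge_sets G) (card_shift 1)) =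
     2 powi (3 * int (card (edges G)) - 2 * int (card (verts G))) *
       real (chromatic_count G 4) / real (flow_count G src tgt 4)"
proof -
  let ?E = "edges G" and ?\<Gamma> = "Collect (eulerian_cover G)"
  let ?U = "Pow ?E \<times> Pow ?E"
  obtain C where C: "triangle_double_cover G C"
    using assms by blast
  note fin = finite_multigraphD[OF assms(1)]
  have sub: "?\<Gamma> \<subseteq> ?U"
    by (auto simp: eulerian_cover_def eulerian_def)
  then have fin\<Gamma>: "finite ?\<Gamma>"
    by (rule finite_subset) (use fin in simp)
  have sym\<Gamma>: "\<forall>P\<in>?\<Gamma>. prod.swap P \<in> ?\<Gamma>"
    by (auto simp: eulerian_cover_def)
  have symU: "\<forall>P\<in>?U. prod.swap P \<in> ?U" and finU: "finite ?U"
    using fin by auto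
  note \<Gamma> = symmetric_card_shift[OF fin\<Gamma> sym\<Gamma>] and U = symmetric_card_shift[OF finU symU]
  \<comment> \<open>By \<open>symmetric_card_shift\<close> these are the real values of the sums of
    \<open>\<omega> ^ (card A + 2 * card B)\<close> over the event and over all pairs.\<close>
  define d\<Gamma> dU :: real where
    "d\<Gamma> = card {P \<in> ?\<Gamma>. card_shift 0 P} - real (card {P \<in> ?\<Gamma>. card_shift 1 P})" and
    "dU = card {P \<in> ?U. card_shift 0 P} - real (card {P \<in> ?U. card_shift 1 P})"
  have "complex_of_real dU = 1"
    using sum_\<omega>_all_pairs[OF fin(2)] unfolding U(2) dU_def by simp
  then have dU: "dU = 1"
    by simp
  have "complex_of_real (4 ^ card (verts G) * d\<Gamma>) =
      complex_of_real (2 ^ card ?E * chromatic_count G 4)"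
    using sum_\<omega>_eulerian_cover[OF assms(1,3) C] unfolding \<Gamma>(2) d\<Gamma>_def by simp
  then have d\<Gamma>: "4 ^ card (verts G) * d\<Gamma> = 2 ^ card ?E * chromatic_count G 4"
    by (simp only: of_real_eq_iff)
  have F: "card ?\<Gamma> = flow_count G src tgt 4"
    by (rule card_eulerian_cover[OF assms(1,3)])
  show ?thesis
  proof (cases "card ?\<Gamma> = 0")
    \<comment> \<open>Without 4-flows, both quotients are 0 by the convention on division by
      zero.\<close>
    case True
    then have "eulerian_cover G P = False" for P
      using fin\<Gamma> by (cases P) auto
    then have "cond_bias (random_edge_sets G) S (eulerian_cover G) = 0" for S
      by (simp add: cond_bias_def cond_prob_def)
    then show ?thesis
      using True F by simp
  next
    case False
    note cb = cond_bias_card_shift[OF fin(2) False]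
    have "cond_bias (random_edge_sets G) (card_shift 0) (eulerian_cover G) -
        cond_bias (random_edge_sets G) (card_shift 1) (eulerian_cover G) = 2 * d\<Gamma> / card ?\<Gamma>"
      by (simp add: cb d\<Gamma>_def right_diff_distrib diff_divide_distrib)
    moreover have "bias (random_edge_sets G) (card_shift 0) - bias (random_edge_sets G) (card_shift 1) =
        2 / 4 ^ card ?E"
    proof -
      have "bias (random_edge_sets G) (card_shift 0) - bias (random_edge_sets G) (card_shift 1) =
          2 * dU / 4 ^ card ?E"
        by (simp add: bias_card_shift[OF fin(2)] dU_def right_diff_distrib diff_divide_distrib)
      then show ?thesis
        by (simp add: dU)
    qed
    \<comment> \<open>The factor \<open>4 ^ card ?E\<close> is what dividing
      \<open>2 * d\<Gamma>\<close> by the unconditional difference \<open>2 / 4 ^ card ?E\<close>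
      produces.\<close>
    moreover have "2 powi (3 * int (card ?E) - 2 * int (card (verts G))) * real (chromatic_count G 4) =
        4 ^ card ?E * d\<Gamma>"
    proof -
      have "(2::real) powi (3 * int (card ?E) - 2 * int (card (verts G))) =
          2 powi int (3 * card ?E) / 2 powi int (2 * card (verts G))"
        by (simp add: power_int_diff)
      also have "\<dots> = 8 ^ card ?E / 4 ^ card (verts G)"
        by (simp only: power_int_of_nat power_mult) simp
      also have "8 ^ card ?E = (4 ^ card ?E * 2 ^ card ?E :: real)"
        by (simp flip: power_mult_distrib)
      finally have "2 powi (3 * int (card ?E) - 2 * int (card (verts G))) * real (chromatic_count G 4) =
          4 ^ card ?E * (2 ^ card ?E * real (chromatic_count G 4)) / 4 ^ card (verts G)"
        by simp
      also have "\<dots> = 4 ^ card ?E * (4 ^ card (verts G) * d\<Gamma>) / 4 ^ card (verts G)"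
        using d\<Gamma> by simp
      finally show ?thesis
        by simp
    qed
    ultimately show ?thesis
      using \<Gamma>(1) by (simp add: cb F)
  qed
qed

end
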